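(* Fix $f\in\mathbb{R}^m$ and let $p(\cdot|f)$ be the posterior density on $\mathbb{R}^n$ given by $p(u|f)\propto\exp(-E(u;K,f)-\alpha R(u))$. Assume the decay condition $$\lim_{r\to\infty}\int_{\partial\mathcal{B}_r(0)}p(u|f)\,\mathrm{d}s=0 .$$ Let $\hat u_{\mathrm{MAP}}\in\arg\max_{u\in\mathbb{R}^n}p(u|f)$ be a maximum a posteriori estimate. Then $\hat u_{\mathrm{MAP}}$ is a Bayes estimator for the cost functional $$C(\hat u,u)=D_E(\hat u,u)+\alpha\,D_R(\hat u,u),$$ that is, $$\hat u_{\mathrm{MAP}}\in\arg\min_{\hat u\in\mathbb{R}^n}\int_{\mathbb{R}^n}C(\hat u,u)\,p(u|f)\,\mathrm{d}u .$$
   Context: Setting: $K\in\mathbb{R}^{m\times n}$ is a linear forward operator, $f\in\mathbb{R}^m$ is the data, $\alpha>0$. The data fidelity $u\mapsto E(u;K,f)$ and the functional $R:\mathbb{R}^n\to\mathbb{R}$ are nonnegative, convex and Lipschitz-continuous on $\mathbb{R}^n$, and $\int_{\mathbb{R}^n}\exp(-E(u;K,f)-\alpha R(u))\,\mathrm{d}u<\infty$. The symbol $\propto$ means equality up to a positive factor independent of $u$; $p(\cdot|f)$ is normalized to be a probability density. $\mathcal{B}_r(0)$ is the Euclidean ball of radius $r$ centred at $0$ and $\mathrm{d}s$ is surface measure. For a convex function $F:\mathbb{R}^n\to\mathbb{R}$ and a subgradient $q\in\partial F(u)$, the Bregman distance is $D_F^q(\hat u,u)=F(\hat u)-F(u)-\langle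 q,\hat u-u\rangle$. $D_E$ denotes the Bregman distance of the function $u\mapsto E(u;K,f)$. The subgradient superscript is omitted because, the functionals being Lipschitz-continuous, the subdifferential at $u$ is a singleton for almost every $u$; hence $D_E(\hat u,u)$ and $D_R(\hat u,u)$ are well defined for almost every $u$. A Bayes estimator for a cost $C$ is an estimator minimizing the expected cost; since the estimator depends only on $f$, this amounts to minimizing, for given $f$, the posterior expected cost $\hat u\mapsto\int C(\hat u,u)p(u|f)\,\mathrm{d}u$. *)

theory Defs
  imports "HOL-Analysis.Analysis"
begin

definition subdifferential :: "('a::euclidean_space \<Rightarrow> real) \<Rightarrow> 'a \<Rightarrow> 'a set" where
  "subdifferential F u = {q. \<forall>v. F v \<ge> F u + q \<bullet> (v - u)}"

definition bregman :: "('a::euclidean_space \<Rightarrow> real) \<Rightarrow> 'a \<Rightarrow> 'a \<Rightarrow> 'a \<Rightarrow> real" where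
  "bregman F q v u = F v - F u - q \<bullet> (v - u)"

text \<open>
  The Bregman distance with the subgradient superscript omitted. It is meaningful where the
  subdifferential at \<open>u\<close> is a singleton, hence for almost every \<open>u\<close> if \<open>F\<close> is convex. On the
  remaining null set its value is unspecified and need not be a Borel function of \<open>u\<close>; integrals
  in \<open>u\<close> are therefore taken with respect to the complete measure \<open>lebesgue\<close>, not \<open>lborel\<close>.
\<close>
definition bregman_distance :: "('a::euclidean_space \<Rightarrow> real) \<Rightarrow> 'a \<Rightarrow> 'a \<Rightarrow> real" where
  "bregman_distance F v u = bregman F (THE q. q \<in> subdifferential F u) v u"

text \<open>
  For fixed data, \<open>p\<close> is the posterior density and \<open>C v u\<close> the cost of estimating \<open>v\<close> when \<open>u\<close> is
  the truth. Bochner integrals of non-integrable functions are \<open>0\<close> by convention, so finiteness of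
  all the expected costs that are compared is made part of the definition.
\<close>
definition bayes_estimate ::
    "('a::euclidean_space \<Rightarrow> 'a \<Rightarrow> real) \<Rightarrow> ('a \<Rightarrow> real) \<Rightarrow> 'a \<Rightarrow> bool" where
  "bayes_estimate C p w \<longleftrightarrow>
     (\<forall>v. integrable lebesgue (\<lambda>u. C v u * p u)) \<and>
     is_arg_min (\<lambda>v. LINT u|lebesgue. C v u * p u) (\<lambda>_. True) w"

text \<open>
  Surface measure on the sphere of radius \<open>r > 0\<close> about \<open>0\<close>, as a Borel measure on the whole space:
  a set of directions gets \<open>n / r\<close> times the volume of the cone over it inside the ball, because
  a cone of height \<open>r\<close> over a piece of area \<open>s\<close> of the sphere has volume \<open>r * s / n\<close>. The lemmas
  below show that it is carried by the sphere, has the right total mass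
  \<open>n * unit_ball_vol n * r ^ (n - 1)\<close> and is invariant under orthogonal transformations; these
  properties determine it uniquely.
\<close>
definition sphere_measure :: "real \<Rightarrow> 'a::euclidean_space measure" where
  "sphere_measure r =
     scale_measure (ennreal (real DIM('a) / r))
       (distr (restrict_space lborel (cball 0 r)) borel (\<lambda>x. (r / norm x) *\<^sub>R x))"

lemma sets_sphere_measure [simp, measurable_cong]: "sets (sphere_measure r) = sets borel"
  by (simp add: sphere_measure_def)

lemma space_sphere_measure [simp]: "space (sphere_measure r) = UNIV"
  by (simp add: sphere_measure_def space_scale_measure)

lemma emeasure_sphere_measure:
  fixes A :: "'a::euclidean_space set"
  assumes A: "A \<in> sets borel"
  shows "emeasure (sphere_measure r) A =
           ennreal (real DIM('a) / r) * emeasure lborel {x \<in> cball 0 r. (r / norm x) *\<^sub>R x \<in> A}"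
proof -
  have [measurable]: "(\<lambda>x::'a. (r / norm x) *\<^sub>R x) \<in> restrict_space lborel (cball 0 r) \<rightarrow>\<^sub>M borel"
    by (rule measurable_restrict_space1) simp
  have "(\<lambda>x::'a. (r / norm x) *\<^sub>R x) -` A \<inter> space (restrict_space lborel (cball 0 r))
          = {x \<in> cball 0 r. (r / norm x) *\<^sub>R x \<in> A}"
    by (auto simp: space_restrict_space)
  moreover have "emeasure (restrict_space lborel (cball 0 r)) {x \<in> cball 0 r. (r / norm x) *\<^sub>R x \<in> A} =
                   emeasure lborel {x \<in> cball 0 r. (r / norm x) *\<^sub>R x \<in> A}"
    by (rule emeasure_restrict_space) auto
  ultimately show ?thesis
    using A by (simp add: sphere_measure_def emeasure_distr del: mem_cball_0)
qed

lemma sphere_measure_mass: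
  assumes r: "r > 0"
  shows "emeasure (sphere_measure r :: 'a::euclidean_space measure) UNIV =
           ennreal (real DIM('a) * unit_ball_vol (real DIM('a)) * r ^ (DIM('a) - 1))"
proof -
  have "emeasure (sphere_measure r :: 'a measure) UNIV =
          ennreal (real DIM('a) / r) * ennreal (unit_ball_vol (real DIM('a)) * r ^ DIM('a))"
    using r emeasure_cball[of r "0::'a"] by (simp add: emeasure_sphere_measure cball_def)
  also have "\<dots> = ennreal (real DIM('a) / r * (unit_ball_vol (real DIM('a)) * r ^ DIM('a)))"
    using r by (subst ennreal_mult) auto
  also have "real DIM('a) / r * (unit_ball_vol (real DIM('a)) * r ^ DIM('a)) =
               real DIM('a) * unit_ball_vol (real DIM('a)) * r ^ (DIM('a) - 1)"
    using r by (cases "DIM('a)") (auto simp: field_simps)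
  finally show ?thesis .
qed

lemma AE_sphere_measure:
  assumes r: "r > 0"
  shows "AE x in (sphere_measure r :: 'a::euclidean_space measure). norm x = r"
proof (rule AE_I')
  have "{x \<in> cball 0 r. (r / norm x) *\<^sub>R x \<in> - sphere 0 r} \<subseteq> {0::'a}"
    using r by auto
  then have "emeasure lborel {x \<in> cball 0 r. (r / norm x) *\<^sub>R x \<in> - sphere (0::'a) r} = 0"
    by (intro emeasure_lborel_countable) (rule countable_subset, auto)
  then show "- sphere (0::'a) r \<in> null_sets (sphere_measure r)"
    by (simp add: null_sets_def emeasure_sphere_measure)
qed auto

lemma sphere_measure_orthogonal:
  fixes T :: "real ^ 'n::{finite,wellorder} \<Rightarrow> real ^ 'n::_"
  assumes T: "orthogonal_transformation T" and A: "A \<in> sets borel"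
  shows "emeasure (sphere_measure r) (T -` A) = emeasure (sphere_measure r) A"
proof -
  have lin: "linear T" and nT: "\<And>x. norm (T x) = norm x"
    using T by (auto simp: orthogonal_transformation)
  have cT: "continuous_on UNIV T"
    using lin by (simp add: linear_continuous_on linear_linear)
  then have [measurable]: "T \<in> borel_measurable borel"
    by (rule borel_measurable_continuous_onI)
  have TA: "T -` A \<in> sets borel"
    using measurable_sets[OF \<open>T \<in> borel_measurable borel\<close> A] by simp
  let ?C = "\<lambda>A. {x \<in> cball 0 r. (r / norm x) *\<^sub>R x \<in> A}"
  have meas: "?C B \<in> sets borel" if [measurable]: "B \<in> sets borel" for B :: "(real ^ 'n::_) set"
    by measurable
  have bdd: "?C B \<in> lmeasurable" if "B \<in> sets borel" for B :: "(real ^ 'n::_) set"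
  proof (rule bounded_set_imp_lmeasurable)
    show "bounded (?C B)"
      by (rule bounded_subset[of "cball 0 r"]) auto
    show "?C B \<in> sets lebesgue"
      using meas[OF that] by (simp add: sets_completionI_sets)
  qed
  have eq: "emeasure lborel (?C B) = ennreal (measure lebesgue (?C B))"
    if "B \<in> sets borel" for B :: "(real ^ 'n::_) set"
  proof -
    have "emeasure lborel (?C B) = emeasure lebesgue (?C B)"
      using meas[OF that] by simp
    also have "\<dots> = ennreal (measure lebesgue (?C B))"
      by (rule emeasure_eq_measure2[OF bdd[OF that]])
    finally show ?thesis .
  qed
  have "?C A = T ` ?C (T -` A)"
  proof -
    have "x \<in> T ` ?C (T -` A)" if "x \<in> ?C A" for x
    proof -
      obtain y where y: "x = T y"
        using orthogonal_transformation_surj[OF T] by (meson surjD)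
      then show ?thesis
        using that nT lin by (auto simp: linear_scale)
    qed
    then show ?thesis
      using nT lin by (auto simp: linear_scale)
  qed
  then have "measure lebesgue (?C A) = measure lebesgue (?C (T -` A))"
    using measure_orthogonal_image[OF T bdd[OF TA]] by simp
  then show ?thesis
    unfolding emeasure_sphere_measure[OF A] emeasure_sphere_measure[OF TA] eq[OF A] eq[OF TA]
    by simp
qed

end

theory Submission
  imports Defs
begin

text \<open>
  Write \<open>J = E + \<alpha> R\<close>, so that \<open>p\<close> is a multiple of \<open>exp (- J)\<close> and \<open>u_MAP\<close> minimizes \<open>J\<close>. For almost
  every \<open>u\<close> the cost is \<open>C v u = J v - J u - \<nabla>J u \<bullet> (v - u) = C 0 u + (J v - J 0) - \<nabla>J u \<bullet> v\<close>. Since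
  \<open>\<nabla>J p = - \<nabla>p\<close>, the last term integrates to zero, so the expected cost is \<open>J v\<close> plus a constant.
  Instead of the divergence theorem, translation invariance of Lebesgue measure is applied to the
  difference quotients of \<open>exp (- J)\<close>, which have an integrable majorant because \<open>J\<close> is Lipschitz.
  Integrability of \<open>C 0 u p u\<close> comes from the behaviour of Lebesgue measure under dilations.
\<close>

section \<open>Existence of subgradients\<close>

lemma subdifferentialD: "q \<in> subdifferential F u \<Longrightarrow> F u + q \<bullet> (v - u) \<le> F v"
  by (auto simp: subdifferential_def)

text \<open>The epigraph has a supporting hyperplane at its boundary point \<open>(u, F u)\<close>.
  Since \<open>F\<close> is finite everywhere, this hyperplane is not vertical, so its normal
  \<open>(b, \<beta>)\<close> yields the slope \<open>- b / \<beta>\<close>.\<close>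

lemma subdifferential_nonempty:
  fixes F :: "'a::euclidean_space \<Rightarrow> real"
  assumes F: "convex_on UNIV F"
  shows "subdifferential F u \<noteq> {}"
proof -
  have notin: "(u, F u) \<notin> rel_interior (epigraph UNIV F)"
  proof
    assume "(u, F u) \<in> rel_interior (epigraph UNIV F)"
    then obtain e where e: "e > 0" "cball (u, F u) e \<inter> affine hull epigraph UNIV F \<subseteq> epigraph UNIV F"
      by (auto simp: mem_rel_interior_cball)
    have 1: "(u, F u) \<in> affine hull epigraph UNIV F" "(u, F u + 1) \<in> affine hull epigraph UNIV F"
      by (auto intro!: hull_inc simp: epigraph_def)
    \<comment> \<open>An affine combination of two epigraph points with one negative weight: it lies
      \<open>e\<close> below the graph, yet within distance \<open>e\<close> of
      \<open>(u, F u)\<close>.\<close>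
    have "(1 + e) *\<^sub>R (u, F u) + (- e) *\<^sub>R (u, F u + 1) \<in> affine hull epigraph UNIV F"
      by (rule mem_affine[OF affine_affine_hull 1]) simp
    then have "(u, F u - e) \<in> affine hull epigraph UNIV F"
      by (simp add: scaleR_left_distrib) (simp add: algebra_simps)
    moreover have "(u, F u - e) \<in> cball (u, F u) e"
      using e by (auto simp: dist_Pair_Pair dist_real_def)
    ultimately show False
      using e by (auto simp: epigraph_def)
  qed
  have mem: "(u, F u) \<in> epigraph UNIV F"
    by (simp add: epigraph_def)
  obtain a where a: "a \<noteq> 0" "\<And>y. y \<in> epigraph UNIV F \<Longrightarrow> a \<bullet> (u, F u) \<le> a \<bullet> y"
    by (rule supporting_hyperplane_rel_boundary[OF convex_epigraphI[OF F] mem notin]) (rule that)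
  obtain b \<beta> where ab: "a = (b, \<beta>)"
    by (cases a)
  have le: "b \<bullet> u + \<beta> * F u \<le> b \<bullet> w + \<beta> * t" if "F w \<le> t" for w t
    using a(2)[of "(w, t)"] that by (simp add: ab epigraph_def)
  have "\<beta> \<ge> 0"
    using le[of u "F u + 1"] by (simp add: algebra_simps)
  \<comment> \<open>A vertical hyperplane is refuted by moving from \<open>u\<close> against its
    normal, to \<open>u - b\<close>.\<close>
  moreover have "\<beta> \<noteq> 0"
  proof
    assume "\<beta> = 0"
    then have "b \<bullet> b \<le> 0"
      using le[of "u - b" "F (u - b)"] by (simp add: inner_diff_right)
    then have "b = 0"
      by (metis inner_gt_zero_iff not_less)
    then show False
      using a(1) ab \<open>\<beta> = 0\<close> by (simp add: zero_prod_def)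
  qed
  ultimately have "\<beta> > 0" by simp
  have "(- (1 / \<beta>)) *\<^sub>R b \<in> subdifferential F u"
    unfolding subdifferential_def
  proof clarify
    fix v
    show "F u + (- (1 / \<beta>)) *\<^sub>R b \<bullet> (v - u) \<le> F v"
      using le[of v "F v"] \<open>\<beta> > 0\<close> by (simp add: inner_diff_right field_simps)
  qed
  then show ?thesis by blast
qed

section \<open>One-sided directional derivatives and the gradient\<close>

text \<open>One-sided derivative along the steps \<open>e / (n + 1)\<close>; for convex \<open>F\<close> the limit always exists.\<close>
definition dir_deriv :: "('a::euclidean_space \<Rightarrow> real) \<Rightarrow> 'a \<Rightarrow> 'a \<Rightarrow> real" where
  "dir_deriv F e u = lim (\<lambda>n. real (Suc n) * (F (u + e /\<^sub>R real (Suc n)) - F u))"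

text \<open>Built from the one-sided derivatives, so that it is Borel on the whole space; it is a subgradient
  only where the one-sided derivatives along each \<open>b\<close> and \<open>- b\<close> match.\<close>
definition gradient :: "('a::euclidean_space \<Rightarrow> real) \<Rightarrow> 'a \<Rightarrow> 'a" where
  "gradient F u = (\<Sum>b\<in>Basis. dir_deriv F b u *\<^sub>R b)"

context
  fixes F :: "'a::euclidean_space \<Rightarrow> real"
  assumes F: "convex_on UNIV F"
begin

lemma convex_borel_measurable: "F \<in> borel_measurable borel"
  by (intro borel_measurable_continuous_onI convex_on_continuous F open_UNIV)

lemma subgradient_le_diff_quotient:
  assumes "q \<in> subdifferential F u"
  shows "q \<bullet> e \<le> real (Suc n) * (F (u + e /\<^sub>R real (Suc n)) - F u)"
  using subdifferentialD[OF assms, of "u + e /\<^sub>R real (Suc n)"] by (simp add: field_simps)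

text \<open>By convexity the quotients decrease as the step shrinks, and any subgradient bounds them
  from below.\<close>

lemma LIMSEQ_dir_deriv:
  "(\<lambda>n. real (Suc n) * (F (u + e /\<^sub>R real (Suc n)) - F u)) \<longlonglongrightarrow> dir_deriv F e u" (is "?X \<longlonglongrightarrow> _")
proof -
  obtain q where q: "q \<in> subdifferential F u"
    using subdifferential_nonempty[OF F] by blast
  have "decseq ?X"
  proof (rule decseq_SucI)
    fix n
    \<comment> \<open>With this weight, \<open>u + e / (n + 2)\<close> is a convex combination of
      \<open>u\<close> and \<open>u + e / (n + 1)\<close>.\<close>
    define t where "t = real (Suc n) / real (Suc (Suc n))"
    have t: "0 \<le> t" "t \<le> 1" "t > 0"
      by (auto simp: t_def)
    have "(1 - t) *\<^sub>R u + t *\<^sub>R (u + e /\<^sub>R real (Suc n)) = u + (t / real (Suc n)) *\<^sub>R e"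
      by (simp add: algebra_simps divide_inverse)
    also have "t / real (Suc n) = inverse (real (Suc (Suc n)))"
      by (simp add: t_def divide_inverse)
    finally have "F (u + e /\<^sub>R real (Suc (Suc n))) \<le> (1 - t) * F u + t * F (u + e /\<^sub>R real (Suc n))"
      using convex_onD[OF F t(1,2), of u "u + e /\<^sub>R real (Suc n)"] by simp
    then have "F (u + e /\<^sub>R real (Suc (Suc n))) - F u \<le> t * (F (u + e /\<^sub>R real (Suc n)) - F u)"
      by (simp add: algebra_simps)
    then have "real (Suc (Suc n)) * (F (u + e /\<^sub>R real (Suc (Suc n))) - F u)
        \<le> real (Suc (Suc n)) * (t * (F (u + e /\<^sub>R real (Suc n)) - F u))"
      by (rule mult_left_mono) simp
    also have "\<dots> = ?X n"
      by (simp add: t_def)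
    finally show "?X (Suc n) \<le> ?X n" .
  qed
  moreover have "\<forall>n. q \<bullet> e \<le> ?X n"
    using subgradient_le_diff_quotient[OF q] by blast
  ultimately obtain L where "?X \<longlonglongrightarrow> L"
    by (rule decseq_convergent) blast
  then show ?thesis
    unfolding dir_deriv_def by (simp add: limI)
qed

lemma subgradient_le_dir_deriv:
  assumes "q \<in> subdifferential F u"
  shows "q \<bullet> e \<le> dir_deriv F e u"
  by (rule LIMSEQ_le_const[OF LIMSEQ_dir_deriv])
     (use subgradient_le_diff_quotient[OF assms] in blast)

lemma dir_deriv_borel_measurable: "dir_deriv F e \<in> borel_measurable borel"
proof (rule borel_measurable_LIMSEQ_real)
  note convex_borel_measurable [measurable]
  show "(\<lambda>u. real (Suc n) * (F (u + e /\<^sub>R real (Suc n)) - F u)) \<in> borel_measurable borel" for n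
    by measurable
qed (rule LIMSEQ_dir_deriv)

lemma gradient_borel_measurable: "gradient F \<in> borel_measurable borel"
  unfolding gradient_def[abs_def]
  by (intro borel_measurable_sum borel_measurable_scaleR borel_measurable_const dir_deriv_borel_measurable)

lemma dir_deriv_add_uminus_nonneg: "0 \<le> dir_deriv F e u + dir_deriv F (- e) u"
proof -
  obtain q where q: "q \<in> subdifferential F u"
    using subdifferential_nonempty[OF F] by blast
  show ?thesis
    using subgradient_le_dir_deriv[OF q, of e] subgradient_le_dir_deriv[OF q, of "- e"] by simp
qed

text \<open>Each component \<open>q \<bullet> b\<close> of a subgradient lies between
  \<open>- dir_deriv F (- b) u\<close> and \<open>dir_deriv F b u\<close>. When these agree, all
  components are determined.\<close>

lemma subdifferential_eq_gradient:
  assumes "\<And>b. b \<in> Basis \<Longrightarrow> dir_deriv F b u + dir_deriv F (- b) u = 0"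
  shows "subdifferential F u = {gradient F u}"
proof -
  have "q = gradient F u" if q: "q \<in> subdifferential F u" for q
  proof (rule euclidean_eqI)
    fix b :: 'a assume b: "b \<in> Basis"
    then have "q \<bullet> b = dir_deriv F b u"
      using subgradient_le_dir_deriv[OF q, of b] subgradient_le_dir_deriv[OF q, of "- b"]
        assms[OF b] by simp
    then show "q \<bullet> b = gradient F u \<bullet> b"
      using b by (simp add: gradient_def)
  qed
  then show ?thesis
    using subdifferential_nonempty[OF F] by blast
qed

end

lemma dir_deriv_add_cmult:
  fixes F G :: "'a::euclidean_space \<Rightarrow> real"
  assumes "convex_on UNIV F" "convex_on UNIV G"
  shows "dir_deriv (\<lambda>w. F w + a * G w) e u = dir_deriv F e u + a * dir_deriv G e u"
proof -
  have "(\<lambda>n. real (Suc n) * (F (u + e /\<^sub>R real (Suc n)) + a * G (u + e /\<^sub>R real (Suc n)) - (F u + a * G u)))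
      \<longlonglongrightarrow> dir_deriv F e u + a * dir_deriv G e u"
    using tendsto_add[OF LIMSEQ_dir_deriv[OF assms(1), of u e]
        tendsto_mult_left[OF LIMSEQ_dir_deriv[OF assms(2), of u e], of a]]
    by (simp add: algebra_simps)
  then show ?thesis
    unfolding dir_deriv_def[of "\<lambda>w. F w + a * G w"] by (rule limI)
qed

section \<open>Affine substitutions and estimates for the exponential\<close>

lemma
  fixes g :: "'a::euclidean_space \<Rightarrow> real"
  assumes g: "integrable lborel g" and c: "c \<noteq> 0"
  shows lborel_integrable_affine: "integrable lborel (\<lambda>x. g (t + c *\<^sub>R x))" (is ?int)
    and lborel_integral_affine:
      "(\<integral>x. g (t + c *\<^sub>R x) \<partial>lborel) = (\<integral>x. g x \<partial>lborel) / \<bar>c\<bar> ^ DIM('a)" (is ?eq)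
proof -
  have [measurable]: "g \<in> borel_measurable borel"
    using borel_measurable_integrable[OF g] by simp
  have D: "density (distr lborel borel (\<lambda>x. t + c *\<^sub>R x)) (\<lambda>_. ennreal (\<bar>c\<bar> ^ DIM('a))) = (lborel :: 'a measure)"
    by (rule lborel_affine[OF c, symmetric])
  have "integrable (density (distr lborel borel (\<lambda>x. t + c *\<^sub>R x)) (\<lambda>_. ennreal (\<bar>c\<bar> ^ DIM('a)))) g"
    unfolding D by (rule g)
  then show ?int
    using c by (simp add: integrable_density integrable_distr_eq)
  have "(\<integral>x. g x \<partial>lborel) =
      (\<integral>x. g x \<partial>density (distr lborel borel (\<lambda>x. t + c *\<^sub>R x)) (\<lambda>_. ennreal (\<bar>c\<bar> ^ DIM('a))))"
    unfolding D ..
  also have "\<dots> = \<bar>c\<bar> ^ DIM('a) * (\<integral>x. g (t + c *\<^sub>R x) \<partial>lborel)"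
    by (simp add: integral_density integral_distr)
  finally show ?eq
    using c by simp
qed

text \<open>Both bounds are \<open>1 + y \<le> exp y\<close>: at \<open>y = - x\<close>, and at
  \<open>y = x\<close> multiplied by \<open>exp (- x)\<close>. Together they enclose
  \<open>1 - exp (- x)\<close> between two quantities that agree to first order at
  \<open>0\<close>.\<close>

lemma
  fixes x :: real
  shows one_minus_exp_le: "1 - exp (- x) \<le> x"
    and mult_exp_le_one_minus_exp: "x * exp (- x) \<le> 1 - exp (- x)"
proof -
  show "1 - exp (- x) \<le> x"
    using exp_ge_add_one_self[of "- x"] by simp
  have "(1 + x) * exp (- x) \<le> exp x * exp (- x)"
    by (rule mult_right_mono) (auto intro: exp_ge_add_one_self)
  then show "x * exp (- x) \<le> 1 - exp (- x)"
    by (simp add: algebra_simps flip: exp_add)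
qed

lemma LIMSEQ_Suc_mult_one_minus_exp:
  fixes x :: "nat \<Rightarrow> real"
  assumes "(\<lambda>n. real (Suc n) * x n) \<longlonglongrightarrow> l"
  shows "(\<lambda>n. real (Suc n) * (1 - exp (- x n))) \<longlonglongrightarrow> l"
proof (rule tendsto_sandwich)
  have "(\<lambda>n. inverse (real (Suc n)) * (real (Suc n) * x n)) \<longlonglongrightarrow> 0 * l"
    by (rule tendsto_mult[OF LIMSEQ_inverse_real_of_nat assms])
  moreover have "inverse (real (Suc n)) * (real (Suc n) * x n) = x n" for n
    by (simp del: of_nat_Suc)
  ultimately have "x \<longlonglongrightarrow> 0"
    by (simp del: of_nat_Suc)
  then have "(\<lambda>n. exp (- x n)) \<longlonglongrightarrow> exp (- 0)"
    by (intro tendsto_intros)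
  from tendsto_mult[OF assms this]
  show "(\<lambda>n. real (Suc n) * x n * exp (- x n)) \<longlonglongrightarrow> l"
    by simp
  show "\<forall>\<^sub>F n in sequentially. real (Suc n) * x n * exp (- x n) \<le> real (Suc n) * (1 - exp (- x n))"
    using mult_exp_le_one_minus_exp by (auto intro!: always_eventually mult_left_mono simp: mult.assoc)
  show "\<forall>\<^sub>F n in sequentially. real (Suc n) * (1 - exp (- x n)) \<le> real (Suc n) * x n"
    using one_minus_exp_le by (auto intro!: always_eventually mult_left_mono)
qed (rule assms)

section \<open>Integrals against the weight \<open>exp (- J)\<close>\<close>

context
  fixes J :: "'a::euclidean_space \<Rightarrow> real" and L :: real
  assumes J: "convex_on UNIV J"
    and int: "integrable lborel (\<lambda>u. exp (- J u))"
begin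

lemmas J_meas [measurable] = convex_borel_measurable[OF J]

text \<open>Translation invariance makes the integrals of the difference quotients of \<open>exp (- J)\<close> vanish,
  and this passes to the limit.\<close>
lemma has_bochner_integral_dir_deriv_mult_exp:
  assumes L: "L-lipschitz_on UNIV J"
  shows "has_bochner_integral lborel (\<lambda>u. dir_deriv J e u * exp (- J u)) 0"
proof -
  \<comment> \<open>The difference quotient of \<open>exp (- J)\<close> with reversed sign, so that
    the limit is \<open>dir_deriv J e u * exp (- J u)\<close>.\<close>
  define h where "h n u = real (Suc n) * (exp (- J u) - exp (- J (u + e /\<^sub>R real (Suc n))))" for n u
  have [measurable]: "h n \<in> borel_measurable borel" for n
    unfolding h_def by measurable
  have meas: "(\<lambda>u. dir_deriv J e u * exp (- J u)) \<in> borel_measurable lborel"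
    using dir_deriv_borel_measurable[OF J, of e] by measurable
  have h_eq: "h n u = real (Suc n) * (1 - exp (- (J (u + e /\<^sub>R real (Suc n)) - J u))) * exp (- J u)" for n u
    by (simp add: h_def left_diff_distrib mult.assoc flip: exp_add)
  have lim: "(\<lambda>n. h n u) \<longlonglongrightarrow> dir_deriv J e u * exp (- J u)" for u
    unfolding h_eq
    by (intro tendsto_mult tendsto_const LIMSEQ_Suc_mult_one_minus_exp LIMSEQ_dir_deriv[OF J])
  define M where "M = L * norm e"
  have M: "M \<ge> 0"
    using lipschitz_on_nonneg[OF L] by (simp add: M_def)
  \<comment> \<open>The Lipschitz condition bounds \<open>(n + 1) * \<bar>x\<bar>\<close> by
    \<open>M\<close>, hence also \<open>\<bar>x\<bar>\<close>. The estimate \<open>\<bar>1 - exp (-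
    x)\<bar> \<le> \<bar>x\<bar> * exp \<bar>x\<bar>\<close> then gives a majorant independent of
    \<open>n\<close>.\<close>
  have bound: "norm (h n u) \<le> M * exp M * exp (- J u)" for n u
  proof -
    define x where "x = J (u + e /\<^sub>R real (Suc n)) - J u"
    have "\<bar>x\<bar> \<le> L * norm (e /\<^sub>R real (Suc n))"
      using lipschitz_onD[OF L, of "u + e /\<^sub>R real (Suc n)" u] by (simp add: x_def dist_norm)
    then have x: "\<bar>x\<bar> * real (Suc n) \<le> M"
      by (simp add: M_def field_simps)
    have "\<bar>x\<bar> * 1 \<le> \<bar>x\<bar> * real (Suc n)"
      by (rule mult_left_mono) auto
    with x have "\<bar>x\<bar> \<le> M" by simp
    have "\<bar>1 - exp (- x)\<bar> \<le> \<bar>x\<bar> * exp \<bar>x\<bar>"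
    proof (cases "x \<ge> 0")
      case True
      then have "x * 1 \<le> x * exp x"
        by (intro mult_left_mono) auto
      then show ?thesis
        using True one_minus_exp_le[of x] by simp
    next
      case False
      then show ?thesis
        using mult_exp_le_one_minus_exp[of x] by simp
    qed
    then have "real (Suc n) * \<bar>1 - exp (- x)\<bar> \<le> (\<bar>x\<bar> * real (Suc n)) * exp \<bar>x\<bar>"
      using mult_left_mono[of "\<bar>1 - exp (- x)\<bar>" "\<bar>x\<bar> * exp \<bar>x\<bar>" "real (Suc n)"]
      by (simp add: mult_ac)
    also have "\<dots> \<le> M * exp M"
      using x \<open>\<bar>x\<bar> \<le> M\<close> M by (intro mult_mono) auto
    finally have "real (Suc n) * \<bar>1 - exp (- x)\<bar> * exp (- J u) \<le> M * exp M * exp (- J u)"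
      by (rule mult_right_mono) simp
    then show ?thesis
      by (simp add: h_eq x_def abs_mult)
  qed
  have bd: "integrable lborel (\<lambda>u. M * exp M * exp (- J u))"
    using int by (rule integrable_mult_right)
  have "(\<integral>u. h n u \<partial>lborel) = 0" for n
  proof -
    have "integrable lborel (\<lambda>u. exp (- J (e /\<^sub>R real (Suc n) + 1 *\<^sub>R u)))"
      by (rule lborel_integrable_affine[OF int]) simp
    moreover have "(\<integral>u. exp (- J (e /\<^sub>R real (Suc n) + 1 *\<^sub>R u)) \<partial>lborel) = (\<integral>u. exp (- J u) \<partial>lborel)"
      by (subst lborel_integral_affine[OF int]) auto
    ultimately show ?thesis
      using int by (simp add: h_def add.commute)
  qed
  moreover have "(\<lambda>n. \<integral>u. h n u \<partial>lborel) \<longlonglongrightarrow> (\<integral>u. dir_deriv J e u * exp (- J u) \<partial>lborel)"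
    by (rule integral_dominated_convergence[OF meas _ bd]) (use lim bound in auto)
  ultimately have "(\<integral>u. dir_deriv J e u * exp (- J u) \<partial>lborel) = 0"
    by (simp add: LIMSEQ_const_iff)
  moreover have "integrable lborel (\<lambda>u. dir_deriv J e u * exp (- J u))"
    by (rule integrable_dominated_convergence[where s = h, OF meas _ bd]) (use lim bound in auto)
  ultimately show ?thesis
    by (simp add: has_bochner_integral_iff)
qed

text \<open>A substitute for Rademacher's theorem: the integrals of the nonnegative jump of the one-sided
  derivatives against \<open>exp (- J)\<close> vanish by the previous lemma.\<close>
lemma AE_dir_deriv_uminus:
  assumes "L-lipschitz_on UNIV J"
  shows "AE u in lborel. \<forall>b\<in>Basis. dir_deriv J b u + dir_deriv J (- b) u = 0"
proof (rule AE_finite_allI)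
  fix e :: 'a
  have hb: "has_bochner_integral lborel
      (\<lambda>u. (dir_deriv J e u + dir_deriv J (- e) u) * exp (- J u)) 0"
    using has_bochner_integral_add[OF has_bochner_integral_dir_deriv_mult_exp[OF assms, of e]
        has_bochner_integral_dir_deriv_mult_exp[OF assms, of "- e"]]
    by (simp add: distrib_right)
  have "AE u in lborel. (dir_deriv J e u + dir_deriv J (- e) u) * exp (- J u) = 0"
    using hb dir_deriv_add_uminus_nonneg[OF J, of e]
    by (subst integral_nonneg_eq_0_iff_AE[symmetric]) (auto simp: has_bochner_integral_iff)
  then show "AE u in lborel. dir_deriv J e u + dir_deriv J (- e) u = 0"
    by simp
qed simp

lemma AE_gradient_subdifferential:
  assumes "L-lipschitz_on UNIV J"
  shows "AE u in lborel. gradient J u \<in> subdifferential J u"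
  using AE_dir_deriv_uminus[OF assms]
  by eventually_elim (simp add: subdifferential_eq_gradient[OF J])

text \<open>The integrated form of \<open>\<nabla>J p = - \<nabla>p\<close>, obtained coordinatewise
  from the one-sided derivatives along the basis vectors.\<close>

lemma has_bochner_integral_gradient_inner_mult_exp:
  assumes "L-lipschitz_on UNIV J"
  shows "has_bochner_integral lborel (\<lambda>u. gradient J u \<bullet> v * exp (- J u)) 0"
proof -
  have "has_bochner_integral lborel
      (\<lambda>u. \<Sum>b\<in>Basis. (b \<bullet> v) * (dir_deriv J b u * exp (- J u))) (\<Sum>b\<in>Basis. (b \<bullet> v) * 0)"
    by (intro has_bochner_integral_sum has_bochner_integral_mult_right
        has_bochner_integral_dir_deriv_mult_exp[OF assms])
  then show ?thesis
    by (simp add: gradient_def inner_sum_left sum_distrib_left sum_distrib_right mult_ac)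
qed

text \<open>The dilation \<open>u \<mapsto> (1 + t) u\<close> changes the integral of \<open>exp (- J)\<close> by the factor \<open>(1 + t) ^ - n\<close>;
  its derivative at \<open>t = 0\<close> formally yields \<open>\<integral> (\<nabla>J u \<bullet> u) exp (- J u) du = n \<integral> exp (- J)\<close>, and
  Fatou's lemma gives the inequality that suffices for integrability.\<close>
lemma integrable_gradient_inner_self_mult_exp:
  assumes L: "L-lipschitz_on UNIV J" and nonneg: "\<And>u. 0 \<le> J u"
  shows "integrable lborel (\<lambda>u. gradient J u \<bullet> u * exp (- J u))"
proof -
  define s where "s u = gradient J u \<bullet> u" for u
  \<comment> \<open>Compensates for negative values of \<open>s\<close>: where the gradient is a
    subgradient, \<open>s u \<ge> - J 0\<close>, so
    \<open>(n + 1) * (exp (- s u / (n + 1)) - 1) \<le> J 0 * exp (J 0)\<close> for every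
    \<open>n\<close>.\<close>
  define A where "A = J 0 * exp (J 0)"
  define I where "I = (\<integral>u. exp (- J u) \<partial>lborel)"
  \<comment> \<open>\<open>k n\<close> is the dilation quotient, whose integral can be computed. In
    \<open>w n\<close> the dilated value of \<open>J\<close> is replaced by its tangent lower bound,
    so that \<open>w n \<le> k n\<close> almost everywhere and the pointwise limit involves
    \<open>s u\<close> directly.\<close>
  define w where "w n u = (real (Suc n) * (1 - exp (- (s u / real (Suc n)))) + A) * exp (- J u)" for n u
  define k where "k n u = real (Suc n) * (exp (- J u) - exp (- J (0 + (1 + 1 / real (Suc n)) *\<^sub>R u)))
      + A * exp (- J u)" for n u
  have [measurable]: "s \<in> borel_measurable borel"
    unfolding s_def[abs_def] using gradient_borel_measurable[OF J] by measurable
  have [measurable]: "w n \<in> borel_measurable borel" for n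
    unfolding w_def[abs_def] by measurable
  have A: "A \<ge> 0"
    using nonneg[of 0] by (simp add: A_def)
  have I: "I \<ge> 0"
    by (simp add: I_def)
  have s_ge: "- J 0 \<le> s u" if "gradient J u \<in> subdifferential J u" for u
    using subdifferentialD[OF that, of 0] nonneg[of u] by (simp add: s_def)
  have w_nonneg: "0 \<le> w n u" if "gradient J u \<in> subdifferential J u" for n u
  proof -
    define x where "x = s u / real (Suc n)"
    have x: "- (J 0 / real (Suc n)) \<le> x"
      using divide_right_mono[OF s_ge[OF that], of "real (Suc n)"] by (simp add: x_def)
    have "exp (- x) \<le> exp (J 0 / real (Suc n))"
      using x by simp
    also have "\<dots> \<le> 1 + J 0 / real (Suc n) * exp (J 0 / real (Suc n))"
      using mult_exp_le_one_minus_exp[of "- (J 0 / real (Suc n))"] by simp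
    also have "\<dots> \<le> 1 + J 0 / real (Suc n) * exp (J 0)"
    proof -
      have "J 0 / real (Suc n) \<le> J 0"
        using nonneg[of 0] by (simp add: field_simps)
      then show ?thesis
        using nonneg[of 0] by (intro add_left_mono mult_left_mono) auto
    qed
    finally have "real (Suc n) * (exp (- x) - 1) \<le> A"
      by (simp add: A_def field_simps)
    then have "0 \<le> real (Suc n) * (1 - exp (- x)) + A"
      by (simp add: algebra_simps)
    then show ?thesis
      by (simp add: w_def x_def)
  qed
  have w_le: "w n u \<le> k n u" if "gradient J u \<in> subdifferential J u" for n u
  proof -
    have eq: "(1 + 1 / real (Suc n)) *\<^sub>R u - u = (1 / real (Suc n)) *\<^sub>R u"
      by (simp add: algebra_simps)
    have "J u + s u / real (Suc n) \<le> J ((1 + 1 / real (Suc n)) *\<^sub>R u)"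
      using subdifferentialD[OF that, of "(1 + 1 / real (Suc n)) *\<^sub>R u"]
      unfolding eq by (simp add: s_def)
    then have "exp (- J ((1 + 1 / real (Suc n)) *\<^sub>R u)) \<le> exp (- (s u / real (Suc n))) * exp (- J u)"
      by (simp flip: exp_add)
    then have "real (Suc n) * (exp (- J u) - exp (- (s u / real (Suc n))) * exp (- J u))
        \<le> real (Suc n) * (exp (- J u) - exp (- J (0 + (1 + 1 / real (Suc n)) *\<^sub>R u)))"
      by (intro mult_left_mono) auto
    then show ?thesis
      by (simp add: w_def k_def algebra_simps)
  qed
  have k_int: "integrable lborel (k n)" for n
    unfolding k_def
    by (intro Bochner_Integration.integrable_add integrable_mult_right Bochner_Integration.integrable_diff int lborel_integrable_affine)
       (auto simp: add_nonneg_eq_0_iff)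
  have k_le: "(\<integral>u. k n u \<partial>lborel) \<le> (DIM('a) + A) * I" for n
  proof -
    define t where "t = 1 / real (Suc n)"
    have t: "t > 0"
      by (simp add: t_def)
    \<comment> \<open>Bernoulli's inequality for \<open>1 / (1 + t) = 1 - t / (1 + t)\<close> bounds
      the loss of mass under dilation to first order in \<open>t\<close>.\<close>
    have "1 - real DIM('a) * t \<le> 1 + real DIM('a) * (- (t / (1 + t)))"
      using t by (simp add: field_simps)
    also have "\<dots> \<le> (1 + - (t / (1 + t))) ^ DIM('a)"
      using t by (intro Bernoulli_inequality) (simp add: field_simps)
    also have "1 + - (t / (1 + t)) = 1 / (1 + t)"
      using t by (simp add: field_simps)
    finally have "I * (1 - real DIM('a) * t) \<le> I * (1 / (1 + t)) ^ DIM('a)"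
      using I by (rule mult_left_mono)
    then have "real (Suc n) * (I - I / (1 + t) ^ DIM('a)) \<le> real (Suc n) * (I * (real DIM('a) * t))"
      by (intro mult_left_mono) (auto simp: algebra_simps power_divide)
    also have "\<dots> = DIM('a) * I"
      by (simp add: t_def)
    finally have *: "real (Suc n) * (I - I / (1 + t) ^ DIM('a)) \<le> DIM('a) * I" .
    have "1 + t \<noteq> 0" "\<bar>1 + t\<bar> = 1 + t"
      using t by auto
    then have "(\<integral>u. k n u \<partial>lborel) = real (Suc n) * (I - I / (1 + t) ^ DIM('a)) + A * I"
      using int lborel_integrable_affine[OF int, of "1 + t" 0] lborel_integral_affine[OF int, of "1 + t" 0]
      unfolding k_def t_def[symmetric] I_def by simp
    with * show ?thesis
      by (simp add: algebra_simps)
  qed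
  have ae: "AE u in lborel. gradient J u \<in> subdifferential J u"
    by (rule AE_gradient_subdifferential[OF L])
  have w_lim: "(\<lambda>n. w n u) \<longlonglongrightarrow> (s u + A) * exp (- J u)" for u
    unfolding w_def
    by (intro tendsto_mult tendsto_add tendsto_const LIMSEQ_Suc_mult_one_minus_exp) simp
  have "(\<integral>\<^sup>+u. ennreal ((s u + A) * exp (- J u)) \<partial>lborel)
      = (\<integral>\<^sup>+u. liminf (\<lambda>n. ennreal (w n u)) \<partial>lborel)"
    by (intro nn_integral_cong lim_imp_Liminf[OF _ tendsto_ennrealI[OF w_lim], symmetric]) simp
  also have "\<dots> \<le> liminf (\<lambda>n. \<integral>\<^sup>+u. ennreal (w n u) \<partial>lborel)"
    by (rule nn_integral_liminf) measurable
  also have "\<dots> \<le> ennreal ((DIM('a) + A) * I)"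
  proof -
    have "(\<integral>\<^sup>+u. ennreal (w n u) \<partial>lborel) \<le> ennreal ((DIM('a) + A) * I)" for n
    proof -
      have "(\<integral>\<^sup>+u. ennreal (w n u) \<partial>lborel) \<le> (\<integral>\<^sup>+u. ennreal (k n u) \<partial>lborel)"
        by (rule nn_integral_mono_AE) (use ae in eventually_elim, intro ennreal_leI w_le)
      also have "\<dots> = ennreal (\<integral>u. k n u \<partial>lborel)"
      proof (rule nn_integral_eq_integral[OF k_int])
        show "AE u in lborel. 0 \<le> k n u"
          using ae by eventually_elim (blast intro: order_trans w_nonneg w_le)
      qed
      also have "\<dots> \<le> ennreal ((DIM('a) + A) * I)"
        by (intro ennreal_leI k_le)
      finally show ?thesis .
    qed
    then have "liminf (\<lambda>n. \<integral>\<^sup>+u. ennreal (w n u) \<partial>lborel) \<le> liminf (\<lambda>n::nat. ennreal ((DIM('a) + A) * I))"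
      by (intro Liminf_mono always_eventually) blast
    then show ?thesis
      by (simp add: Liminf_const)
  qed
  finally have fin: "(\<integral>\<^sup>+u. ennreal ((s u + A) * exp (- J u)) \<partial>lborel) < \<infinity>"
    by (rule le_less_trans) simp
  have "integrable lborel (\<lambda>u. (s u + A) * exp (- J u))"
  proof (rule integrableI_nonneg[OF _ _ fin])
    show "AE u in lborel. 0 \<le> (s u + A) * exp (- J u)"
      using ae by eventually_elim (rule LIMSEQ_le_const[OF w_lim], blast intro: w_nonneg)
  qed measurable
  from Bochner_Integration.integrable_diff[OF this integrable_mult_right[OF int, of A]]
  show ?thesis
    by (simp add: algebra_simps s_def)
qed

text \<open>Passing from \<open>B 0\<close> to \<open>B v\<close> adds a constant multiple of
  \<open>exp (- J)\<close> and a gradient term of integral zero. Hence only the integrability of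
  \<open>B 0\<close> needs the dilation argument.\<close>

lemma
  assumes L: "L-lipschitz_on UNIV J" and nonneg: "\<And>u. 0 \<le> J u"
  defines "B v u \<equiv> bregman J (gradient J u) v u * exp (- J u)"
  shows integrable_bregman_gradient_mult_exp: "integrable lborel (B v)" (is ?int)
    and integral_bregman_gradient_mult_exp:
      "(\<integral>u. B v u \<partial>lborel) = (\<integral>u. B 0 u \<partial>lborel) + (J v - J 0) * (\<integral>u. exp (- J u) \<partial>lborel)" (is ?eq)
proof -
  note gradient_borel_measurable[OF J, measurable]
  note gv = has_bochner_integral_gradient_inner_mult_exp[OF L, of v, unfolded has_bochner_integral_iff]
  have [measurable]: "B v \<in> borel_measurable borel" for v
    unfolding B_def bregman_def by measurable
  have B0: "integrable lborel (B 0)"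
  proof (rule Bochner_Integration.integrable_bound)
    show "integrable lborel (\<lambda>u. J 0 * exp (- J u) + gradient J u \<bullet> u * exp (- J u))"
      by (intro Bochner_Integration.integrable_add integrable_mult_right int
          integrable_gradient_inner_self_mult_exp[OF L nonneg])
    \<comment> \<open>The subgradient inequality at \<open>0\<close> makes \<open>B 0 u\<close>
      nonnegative, and dropping \<open>- J u \<le> 0\<close> bounds it from above.\<close>
    show "AE u in lborel. norm (B 0 u) \<le> norm (J 0 * exp (- J u) + gradient J u \<bullet> u * exp (- J u))"
      using AE_gradient_subdifferential[OF L]
    proof eventually_elim
      case (elim u)
      have "0 \<le> J 0 - J u + gradient J u \<bullet> u"
        using subdifferentialD[OF elim, of 0] by simp
      moreover have "J 0 - J u + gradient J u \<bullet> u \<le> J 0 + gradient J u \<bullet> u"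
        using nonneg[of u] by simp
      ultimately have "\<bar>J 0 - J u + gradient J u \<bullet> u\<bar> \<le> \<bar>J 0 + gradient J u \<bullet> u\<bar>"
        by simp
      then show ?case
        by (simp add: B_def bregman_def abs_mult flip: distrib_right)
    qed
  qed measurable
  have B_eq: "B v = (\<lambda>u. B 0 u + (J v - J 0) * exp (- J u) - gradient J u \<bullet> v * exp (- J u))"
    by (auto simp: B_def bregman_def algebra_simps inner_diff_right)
  show ?int
    unfolding B_eq using B0 int gv by (intro Bochner_Integration.integrable_diff Bochner_Integration.integrable_add integrable_mult_right) auto
  show ?eq
    unfolding B_eq using B0 int gv by simp
qed

end

section \<open>The expected cost as an affine function of \<open>J v\<close>\<close>

theorem theorem3p2:
  fixes E :: "real ^ 'n \<Rightarrow> real ^ 'n ^ 'm \<Rightarrow> real ^ 'm \<Rightarrow> real"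
    and R :: "real ^ 'n \<Rightarrow> real"
    and K :: "real ^ 'n ^ 'm"
    and f :: "real ^ 'm"
    and \<alpha> :: real
    and p :: "real ^ 'n \<Rightarrow> real"
    and u_MAP :: "real ^ 'n"
  assumes "\<alpha> > 0"
    and "\<forall>u. E u K f \<ge> 0"
    and "convex_on UNIV (\<lambda>u. E u K f)"
    and "\<exists>L. L-lipschitz_on UNIV (\<lambda>u. E u K f)"
    and "\<forall>u. R u \<ge> 0"
    and "convex_on UNIV R"
    and "\<exists>L. L-lipschitz_on UNIV R"
    and "integrable lebesgue (\<lambda>u. exp (- E u K f - \<alpha> * R u))"
    and "\<exists>c>0. \<forall>u. p u = c * exp (- E u K f - \<alpha> * R u)"
    and "(LINT u|lebesgue. p u) = 1"
    and "((\<lambda>r. LINT u|sphere_measure r. p u) \<longlongrightarrow> 0) at_top"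
    and "is_arg_max p (\<lambda>_. True) u_MAP"
  shows "bayes_estimate
           (\<lambda>v u. bregman_distance (\<lambda>w. E w K f) v u + \<alpha> * bregman_distance R v u) p u_MAP"
proof -
  define F where "F u = E u K f" for u
  define J where "J u = F u + \<alpha> * R u" for u
  obtain c where c: "c > 0" and p: "\<And>u. p u = c * exp (- J u)"
    using assms(9) by (auto simp: J_def F_def)
  have F: "convex_on UNIV F" and R: "convex_on UNIV R"
    using assms(3,6) by (simp_all add: F_def[abs_def])
  have J: "convex_on UNIV J"
    unfolding J_def[abs_def] using F R assms(1) by (intro convex_on_add convex_on_cmul) auto
  have nonneg: "0 \<le> J u" for u
    using assms(1,2,5) by (simp add: J_def F_def)
  obtain L where L: "L-lipschitz_on UNIV J"
  proof -
    obtain L1 L2 where "L1-lipschitz_on UNIV F" "L2-lipschitz_on UNIV R"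
      using assms(4,7) by (auto simp: F_def[abs_def])
    then have "(L1 + \<bar>\<alpha>\<bar> * L2)-lipschitz_on UNIV J"
      unfolding J_def[abs_def] by (intro lipschitz_on_add lipschitz_on_cmult_real)
    then show thesis
      by (rule that)
  qed
  have [measurable]: "J \<in> borel_measurable borel"
    by (rule convex_borel_measurable[OF J])
  have int: "integrable lborel (\<lambda>u. exp (- J u))"
  proof -
    have "integrable lebesgue (\<lambda>u. exp (- J u))"
      using assms(8) by (simp add: J_def F_def)
    then show ?thesis
      by (subst (asm) integrable_completion) measurable
  qed
  \<comment> \<open>A Borel version of the weighted cost \<open>C\<close>, with the explicit
    gradient in place of the unspecified subgradient.\<close>
  define B where "B v u = c * (bregman J (gradient J u) v u * exp (- J u))" for v u
  define C where "C v u = (bregman_distance (\<lambda>w. E w K f) v u + \<alpha> * bregman_distance R v u) * p u" for v u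
  have dir: "dir_deriv J e u = dir_deriv F e u + \<alpha> * dir_deriv R e u" for e u
    unfolding J_def[abs_def] by (rule dir_deriv_add_cmult[OF F R])
  have grad: "gradient J u = gradient F u + \<alpha> *\<^sub>R gradient R u" for u
    by (simp add: gradient_def dir scaleR_add_left sum.distrib scaleR_sum_right)
  have "AE u in lborel. \<forall>v. C v u = B v u"
    using AE_dir_deriv_uminus[OF J int L]
  proof eventually_elim
    case (elim u)
    \<comment> \<open>The jumps of \<open>F\<close> and \<open>R\<close> are nonnegative and
      \<open>\<alpha> > 0\<close>, so a vanishing jump of \<open>J\<close> forces both to vanish.
      Thus the null set for \<open>J\<close> serves \<open>F\<close> and \<open>R\<close> as
      well.\<close>
    have "dir_deriv F b u + dir_deriv F (- b) u = 0 \<and> dir_deriv R b u + dir_deriv R (- b) u = 0"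
      if b: "b \<in> Basis" for b
    proof -
      have "(dir_deriv F b u + dir_deriv F (- b) u) + \<alpha> * (dir_deriv R b u + dir_deriv R (- b) u) = 0"
        using elim b by (simp add: dir algebra_simps)
      moreover have "0 \<le> \<alpha> * (dir_deriv R b u + dir_deriv R (- b) u)"
        using dir_deriv_add_uminus_nonneg[OF R] assms(1) by simp
      ultimately show ?thesis
        using dir_deriv_add_uminus_nonneg[OF F, of b u] assms(1)
        by (metis add_nonneg_eq_0_iff less_irrefl mult_eq_0_iff)
    qed
    then have "subdifferential F u = {gradient F u}" "subdifferential R u = {gradient R u}"
      using subdifferential_eq_gradient[OF F] subdifferential_eq_gradient[OF R] by auto
    then show ?case
      by (simp add: C_def B_def p bregman_distance_def bregman_def grad J_def
          algebra_simps flip: F_def[abs_def])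
  qed
  then have ae: "AE u in lebesgue. C v u = B v u" for v
    by (intro AE_completion) auto
  have [measurable]: "B v \<in> borel_measurable lborel" for v
    unfolding B_def[abs_def] bregman_def using gradient_borel_measurable[OF J] by measurable
  have Bl: "B v \<in> borel_measurable lebesgue" for v
    by (rule measurable_completion) measurable
  \<comment> \<open>Completeness of \<open>lebesgue\<close> is essential: \<open>C v\<close> is
    controlled only outside a null set.\<close>
  have Cl: "C v \<in> borel_measurable lebesgue" for v
    by (rule borel_measurable_AE[OF Bl]) (use ae[of v] in eventually_elim, simp)
  have "integrable lebesgue (C v)" for v
  proof -
    have "integrable lebesgue (B v)"
      using integrable_bregman_gradient_mult_exp[OF J int L nonneg, of v]
      by (subst integrable_completion) (auto simp: B_def[abs_def])
    then show ?thesis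
      using integrable_cong_AE[OF Cl Bl ae] by simp
  qed
  moreover have val: "(LINT u|lebesgue. C v u) =
      (LINT u|lborel. B 0 u) + c * ((J v - J 0) * (LINT u|lborel. exp (- J u)))" for v
  proof -
    have "(LINT u|lebesgue. C v u) = (LINT u|lborel. B v u)"
      using integral_cong_AE[OF Cl Bl ae] by (simp add: integral_completion)
    then show ?thesis
      using integral_bregman_gradient_mult_exp[OF J int L nonneg, of v]
      by (simp add: B_def distrib_left)
  qed
  \<comment> \<open>Since \<open>c > 0\<close>, maximizing \<open>c * exp (- J u)\<close> means
    minimizing \<open>J\<close>.\<close>
  moreover have "J u_MAP \<le> J v" for v
    using assms(12) c by (auto simp: is_arg_max_def p not_less)
  ultimately show ?thesis
    unfolding bayes_estimate_def is_arg_min_linorder C_def[symmetric] val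
    using c by (auto intro!: mult_left_mono mult_right_mono)
qed

end
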